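(* Let $q:\mathbb{R}^n\to\mathbb{R}^M$, $p:\mathbb{R}^M\to\mathbb{R}^\ell$, $C\in\mathbb{R}^{\ell\times n}$, and let $\mathcal{S}_0=\{(x_i,z_i)\}_{i=1}^{N_0}$ be a finite set of training data with $z_i=q(x_i)$. Let $r>0$, $S\ge 0$, and suppose that the error function $e(x)=p(q(x))-Cx$ is locally $S$-slope bounded with radius $r$ around every training datapoint, i.e. for every $(x_d,z_d)\in\mathcal{S}_0$ and every $x\in B_r(x_d)$, $\|e(x)-e(x_d)\|\le S\|x-x_d\|$. For $\gamma\geq 0$ define the safe set $$\mathcal{X}_\gamma=\bigcup_{(x_d,z_d)\in\mathcal{S}_0}\{x\in B_r(x_d)\;:\;\|p(z_d)-Cx_d\|+S\|x-x_d\|\le\gamma\}.$$ Then for any $(x,z)$ with $z=q(x)$ and $x\in\mathcal{X}_\gamma$, the perception error is bounded: $\|p(z)-Cx\|\le\gamma$.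
   Context: $\|\cdot\|$ denotes fixed norms on $\mathbb{R}^n$ and $\mathbb{R}^\ell$, and $B_r(x_0)=\{x:\|x-x_0\|\le r\}$. The map $q$ is the generative model relating a state $x$ to its observation $z=q(x)$; $p$ is the perception map, which predicts $Cx$ from $z$. *)

theory Defs
  imports "HOL-Analysis.Analysis"
begin

text \<open>
  The norms on the state space and on the output space are arbitrary, so they are
  explicit functions rather than the Euclidean \<open>norm\<close> of the type \<open>real ^ 'n\<close>; accordingly
  \<open>norm_cball\<close> takes the place of \<open>cball\<close>.
\<close>

definition is_norm :: "('a::real_vector \<Rightarrow> real) \<Rightarrow> bool" where
  "is_norm N \<longleftrightarrow>
     (\<forall>x. 0 \<le> N x) \<and>
     (\<forall>x. N x = 0 \<longleftrightarrow> x = 0) \<and>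
     (\<forall>a x. N (a *\<^sub>R x) = \<bar>a\<bar> * N x) \<and>
     (\<forall>x y. N (x + y) \<le> N x + N y)"

definition norm_cball :: "('a::real_vector \<Rightarrow> real) \<Rightarrow> 'a \<Rightarrow> real \<Rightarrow> 'a set" where
  "norm_cball N x\<^sub>0 r = {x. N (x - x\<^sub>0) \<le> r}"

definition perception_error ::
  "(real ^ 'n \<Rightarrow> real ^ 'm) \<Rightarrow> (real ^ 'm \<Rightarrow> real ^ 'l) \<Rightarrow> real ^ 'n ^ 'l \<Rightarrow> real ^ 'n \<Rightarrow> real ^ 'l" where
  "perception_error q p C x = p (q x) - C *v x"

definition locally_slope_bounded ::
  "('a::real_vector \<Rightarrow> real) \<Rightarrow> ('b::real_vector \<Rightarrow> real) \<Rightarrow> real \<Rightarrow> real \<Rightarrow> ('a \<Rightarrow> 'b) \<Rightarrow> 'a \<Rightarrow> bool" where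
  "locally_slope_bounded N\<^sub>X N\<^sub>Y S r f x\<^sub>0 \<longleftrightarrow>
     (\<forall>x \<in> norm_cball N\<^sub>X x\<^sub>0 r. N\<^sub>Y (f x - f x\<^sub>0) \<le> S * N\<^sub>X (x - x\<^sub>0))"

definition safe_set ::
  "(real ^ 'n \<Rightarrow> real) \<Rightarrow> (real ^ 'l \<Rightarrow> real) \<Rightarrow> (real ^ 'm \<Rightarrow> real ^ 'l) \<Rightarrow> real ^ 'n ^ 'l \<Rightarrow>
   ((real ^ 'n) \<times> (real ^ 'm)) set \<Rightarrow> real \<Rightarrow> real \<Rightarrow> real \<Rightarrow> (real ^ 'n) set" where
  "safe_set N\<^sub>X N\<^sub>Y p C S\<^sub>0 S r \<gamma> =
     (\<Union>(x\<^sub>d, z\<^sub>d) \<in> S\<^sub>0. {x \<in> norm_cball N\<^sub>X x\<^sub>d r. N\<^sub>Y (p z\<^sub>d - C *v x\<^sub>d) + S * N\<^sub>X (x - x\<^sub>d) \<le> \<gamma>})"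

end

theory Submission
  imports Defs
begin

text \<open>A point of the safe set comes with a training point \<open>x\<^sub>d\<close> that
  certifies it: the error at \<open>x\<close> exceeds the error at \<open>x\<^sub>d\<close> by at
  most the change of the error function between them, and the slope bound controls that change by
  \<open>S\<close> times the distance. The budget defining the safe set is exactly this sum, so the
  triangle inequality finishes.\<close>

theorem lemma3p1:
  fixes norm\<^sub>X :: "real ^ 'n \<Rightarrow> real"
    and norm\<^sub>Y :: "real ^ 'l \<Rightarrow> real"
    and q :: "real ^ 'n \<Rightarrow> real ^ 'm"
    and p :: "real ^ 'm \<Rightarrow> real ^ 'l"
    and C :: "real ^ 'n ^ 'l"
    and S\<^sub>0 :: "((real ^ 'n) \<times> (real ^ 'm)) set"
    and r S \<gamma> :: real
  assumes "is_norm norm\<^sub>X" and "is_norm norm\<^sub>Y"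
    and "finite S\<^sub>0"
    and "\<forall>(x\<^sub>d, z\<^sub>d) \<in> S\<^sub>0. z\<^sub>d = q x\<^sub>d"
    and "r > 0" and "S \<ge> 0"
    and "\<forall>(x\<^sub>d, z\<^sub>d) \<in> S\<^sub>0. locally_slope_bounded norm\<^sub>X norm\<^sub>Y S r (perception_error q p C) x\<^sub>d"
    and "\<gamma> \<ge> 0"
  shows "\<forall>x z. z = q x \<and> x \<in> safe_set norm\<^sub>X norm\<^sub>Y p C S\<^sub>0 S r \<gamma> \<longrightarrow> norm\<^sub>Y (p z - C *v x) \<le> \<gamma>"
proof (intro allI impI)
  fix x z
  assume "z = q x \<and> x \<in> safe_set norm\<^sub>X norm\<^sub>Y p C S\<^sub>0 S r \<gamma>"
  then obtain x\<^sub>d z\<^sub>d where z: "z = q x" and d: "(x\<^sub>d, z\<^sub>d) \<in> S\<^sub>0"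
    and ball: "x \<in> norm_cball norm\<^sub>X x\<^sub>d r"
    and safe: "norm\<^sub>Y (p z\<^sub>d - C *v x\<^sub>d) + S * norm\<^sub>X (x - x\<^sub>d) \<le> \<gamma>"
    unfolding safe_set_def by blast
  define e where "e = perception_error q p C"
  \<comment> \<open>The safe set is stated through the recorded observation
    \<open>z\<^sub>d\<close>, the slope bound through \<open>q\<close>; consistency of the data,
    \<open>z\<^sub>d = q x\<^sub>d\<close>, identifies the two.\<close>
  have e_d: "e x\<^sub>d = p z\<^sub>d - C *v x\<^sub>d"
    using assms(4) d by (auto simp: e_def perception_error_def)
  have slope: "norm\<^sub>Y (e x - e x\<^sub>d) \<le> S * norm\<^sub>X (x - x\<^sub>d)"
    using assms(7) d ball by (auto simp: e_def locally_slope_bounded_def)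
  \<comment> \<open>The error is recentred at \<open>x\<^sub>d\<close> as a sum, the form in which
    \<open>is_norm\<close> provides subadditivity.\<close>
  have "norm\<^sub>Y (p z - C *v x) = norm\<^sub>Y (e x\<^sub>d + (e x - e x\<^sub>d))"
    by (simp add: z e_def perception_error_def)
  also have "\<dots> \<le> norm\<^sub>Y (e x\<^sub>d) + norm\<^sub>Y (e x - e x\<^sub>d)"
    using assms(2) unfolding is_norm_def by blast
  also have "\<dots> \<le> \<gamma>"
    using slope safe by (simp add: e_d)
  finally show "norm\<^sub>Y (p z - C *v x) \<le> \<gamma>" .
qed

end
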